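(* Let $q$ be a prime power. There is a one-to-one correspondence between the sets of complete mappings of any pair of isotopic polynomials in $\mathcal{LP}_q$. More precisely, if $(h_1,h_2,h_3)$ is an isotopism from a polynomial $f_1\in\mathcal{LP}_q$ to a polynomial $f_2\in\mathcal{LP}_q$, then $g\in\mathcal{P}_q$ is a complete mapping of $f_1$ if and only if $h_2gh_1^{-1}\in\mathcal{P}_q$ is a complete mapping of $f_2$.
   Context: $\mathbb{F}_q$ is the finite field with $q$ elements. $\mathcal{P}_q$ is the set of polynomials in $\mathbb{F}_q[x]$ of degree less than $q$ that act as permutations of $\mathbb{F}_q$; for $f,g\in\mathcal{P}_q$, $fg:=f(g(x))$ modulo $x^q-x$, and $f^{-1}\in\mathcal{P}_q$ is the inverse for this composition. $\mathcal{LP}_q$ is the set of polynomials $f\in\mathbb{F}_q[x,y]$ of degree less than $q$ in each variable such that, for every $a\in\mathbb{F}_q$, both $f(x,a)$ and $f(a,x)$ act as permutations of $\mathbb{F}_q$. An isotopism from $f_1\in\mathcal{LP}_q$ to $f_2\in\mathcal{LP}_q$ is a triple $(h_1,h_2,h_3)\in\mathcal{P}_q^3$ such that $f_2(h_1(x),h_2(y))=h_3(f_1(x,y))$ modulo $x^q-x$ and $y^q-y$; then $f_1$ and $f_2$ are isotopic. For $f\in\mathcal{LP}_q$ and $g_1,g_2\in\mathcal{P}_q$, put $\odot_f(g_1,g_2):=f(g_1(x),g_2(x))\in\mathbb{F}_q[x]$, taken modulo $x^q-x$. A polynomial $g\in\mathcal{P}_q$ is a complete mapping of $f\in\mathcal{LP}_q$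 if $\odot_f(x,g)\in\mathcal{P}_q$. *)

theory Defs
  imports "HOL-Library.Cardinality" "HOL-Computational_Algebra.Computational_Algebra"
begin

text \<open>
  The field with q elements is a type \<open>'a :: {finite, field}\<close>, and \<open>q = CARD('a)\<close>.
  A polynomial in the two variables x, y is an element of \<open>'a poly poly\<close>: the outer variable
  is y, and the coefficients are polynomials in x.
\<close>

definition vanishing_poly :: "'a::{finite,field} poly" where
  "vanishing_poly = monom 1 CARD('a) - monom 1 1"

definition perm_polys :: "'a::{finite,field} poly set" where
  "perm_polys = {f. degree f < CARD('a) \<and> bij (poly f)}"

definition perm_comp :: "'a::{finite,field} poly \<Rightarrow> 'a poly \<Rightarrow> 'a poly" where
  "perm_comp f g = pcompose f g mod vanishing_poly"

definition perm_inv :: "'a::{finite,field} poly \<Rightarrow> 'a poly" where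
  "perm_inv f = (THE g. g \<in> perm_polys \<and>
     perm_comp f g = monom 1 1 \<and> perm_comp g f = monom 1 1)"

text \<open>
  The value f(u, v) for u, v in a commutative ring into which the scalars are mapped
  by a homomorphism \<open>\<iota>\<close>; u replaces x and v replaces y.
\<close>

definition eval2 ::
  "('a::{finite,field} \<Rightarrow> 'b::comm_ring_1) \<Rightarrow> 'a poly poly \<Rightarrow> 'b \<Rightarrow> 'b \<Rightarrow> 'b" where
  "eval2 \<iota> f u v = poly (map_poly (\<lambda>c. poly (map_poly \<iota> c) u) f) v"

definition local_perm_polys :: "'a::{finite,field} poly poly set" where
  "local_perm_polys = {f. degree f < CARD('a) \<and> (\<forall>i. degree (coeff f i) < CARD('a)) \<and>
     (\<forall>a. bij (\<lambda>x. eval2 (\<lambda>c. c) f x a) \<and> bij (\<lambda>x. eval2 (\<lambda>c. c) f a x))}"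

text \<open>
  Congruence modulo the ideal generated by \<open>x ^ q - x\<close> and \<open>y ^ q - y\<close>. For a polynomial p in
  one variable, \<open>[:p:]\<close> is p(x) and \<open>map_poly (\<lambda>c. [:c:]) p\<close> is p(y).
\<close>

definition cong2 :: "'a::{finite,field} poly poly \<Rightarrow> 'a poly poly \<Rightarrow> bool" where
  "cong2 f g \<longleftrightarrow> (\<exists>u v. f - g = u * [:vanishing_poly:] + v * map_poly (\<lambda>c. [:c:]) vanishing_poly)"

definition isotopism ::
  "'a::{finite,field} poly poly \<Rightarrow> 'a poly poly \<Rightarrow> 'a poly \<times> 'a poly \<times> 'a poly \<Rightarrow> bool" where
  "isotopism f1 f2 = (\<lambda>(h1, h2, h3).
     h1 \<in> perm_polys \<and> h2 \<in> perm_polys \<and> h3 \<in> perm_polys \<and>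
     cong2 (eval2 (\<lambda>c. [:[:c:]:]) f2 [:h1:] (map_poly (\<lambda>c. [:c:]) h2))
           (poly (map_poly (\<lambda>c. [:[:c:]:]) h3) f1))"

definition isotopic :: "'a::{finite,field} poly poly \<Rightarrow> 'a poly poly \<Rightarrow> bool" where
  "isotopic f1 f2 \<longleftrightarrow> (\<exists>h. isotopism f1 f2 h)"

definition odot :: "'a::{finite,field} poly poly \<Rightarrow> 'a poly \<Rightarrow> 'a poly \<Rightarrow> 'a poly" where
  "odot f g1 g2 = eval2 (\<lambda>c. [:c:]) f g1 g2 mod vanishing_poly"

definition complete_mappings :: "'a::{finite,field} poly poly \<Rightarrow> 'a poly set" where
  "complete_mappings f = {g \<in> perm_polys. odot f (monom 1 1) g \<in> perm_polys}"

end

theory Submission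
  imports Defs
begin

text \<open>Every object here is determined by the function it induces. Since
  \<open>a ^ q = a\<close> in the field, reduction modulo \<open>x^q - x\<close> preserves values,
  and a polynomial of degree below q is fixed by its values
  (\<open>poly_inject_degree_less_card\<close>); conversely every function is induced by such a
  polynomial (\<open>exists_poly_eq_fun\<close>). So \<open>perm_polys\<close> is the symmetric
  group of the field, with \<open>perm_comp\<close> and \<open>perm_inv\<close> as composition and
  inverse. Pointwise, an isotopism says f2(h1(a), h2(b)) = h3(f1(a, b))
  (\<open>isotopism_eval\<close>). Put b = g(a) and k = h2 g h1^-1: the map x -> f2(x, k(x)),
  precomposed with h1, equals a -> f1(a, g(a)) followed by h3. As h1 and h3 are bijections, one map
  is bijective exactly when the other is. Since g -> h2 g h1^-1 permutes \<open>perm_polys\<close>,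
  it restricts to a bijection between the sets of complete mappings.\<close>

lemma card_field_gt_1: "1 < CARD('a::{finite,field})"
  using card_mono[of UNIV "{0::'a, 1}"] by simp

text \<open>Multiplication by a permutes the nonzero elements, so their product P satisfies a^(q-1)
  P = P, and P is nonzero.\<close>

lemma finite_field_power_card_minus_1:
  fixes a :: "'a::{finite,field}"
  assumes "a \<noteq> 0"
  shows "a ^ (CARD('a) - 1) = 1"
proof -
  let ?S = "UNIV - {0::'a}"
  have "bij_betw (\<lambda>x. a * x) ?S ?S"
    by (rule bij_betwI[where g = "\<lambda>x. x / a"]) (use assms in auto)
  from prod.reindex_bij_betw[OF this, of "\<lambda>x. x"]
  have "a ^ card ?S * \<Prod>?S = \<Prod>?S"
    by (simp add: prod.distrib)
  then show ?thesis
    by simp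
qed

lemma finite_field_power_card:
  fixes a :: "'a::{finite,field}"
  shows "a ^ CARD('a) = a"
proof (cases "a = 0")
  case False
  have "a ^ CARD('a) = a ^ (CARD('a) - 1) * a"
    using card_field_gt_1[where 'a = 'a] by (simp add: power_eq_if)
  then show ?thesis
    by (simp add: finite_field_power_card_minus_1[OF False] del: One_nat_def)
qed (use card_field_gt_1[where 'a = 'a] in simp)

lemma poly_vanishing_poly [simp]: "poly vanishing_poly a = 0"
  by (simp add: vanishing_poly_def poly_monom finite_field_power_card)

lemma degree_vanishing_poly: "degree (vanishing_poly :: 'a::{finite,field} poly) = CARD('a)"
proof -
  have "degree (- monom 1 1 :: 'a poly) < degree (monom 1 CARD('a) :: 'a poly)"
    using card_field_gt_1[where 'a = 'a] by (simp add: degree_monom_eq)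
  from degree_add_eq_left[OF this] show ?thesis
    by (simp add: vanishing_poly_def degree_monom_eq)
qed

lemma degree_mod_vanishing_poly:
  "degree (f mod vanishing_poly :: 'a::{finite,field} poly) < CARD('a)"
  using degree_mod_less[of vanishing_poly f] degree_vanishing_poly[where 'a = 'a]
    card_field_gt_1[where 'a = 'a] by fastforce

lemma poly_mod_vanishing_poly [simp]: "poly (f mod vanishing_poly) a = poly f a"
  by (metis add.left_neutral mult_zero_right poly_add poly_mult poly_vanishing_poly
      div_mult_mod_eq)

text \<open>The difference has degree below q but vanishes at all q points. Equalities in
  \<open>perm_polys\<close> can therefore be checked on values.\<close>

lemma poly_inject_degree_less_card:
  fixes f g :: "'a::{finite,field} poly"
  assumes "degree f < CARD('a)" "degree g < CARD('a)" "poly f = poly g"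
  shows "f = g"
  using assms by (intro poly_eqI_degree[where A = UNIV]) auto

text \<open>
  By Fermat, \<open>1 - (x - a) ^ (q - 1)\<close> takes the value 1 at \<open>a\<close> and 0 elsewhere.
\<close>

lemma exists_poly_eq_fun:
  fixes F :: "'a::{finite,field} \<Rightarrow> 'a"
  obtains f where "degree f < CARD('a)" "poly f = F"
proof
  let ?p = "\<Sum>a\<in>UNIV. smult (F a) (1 - [:- a, 1:] ^ (CARD('a) - 1))"
  have *: "poly (1 - [:- a, 1:] ^ (CARD('a) - 1)) b = (if b = a then 1 else 0)" for a b :: 'a
    using card_field_gt_1[where 'a = 'a] finite_field_power_card_minus_1[of "b - a"]
    by (auto simp: algebra_simps)
  have "poly ?p b = F b" for b
    unfolding poly_sum poly_smult * by (simp add: if_distrib cong: if_cong)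
  then show "poly (?p mod vanishing_poly) = F"
    by (intro ext) (simp only: poly_mod_vanishing_poly)
qed (rule degree_mod_vanishing_poly)

lemma perm_polys_eqI:
  assumes "f \<in> perm_polys" "g \<in> perm_polys" "poly f = poly g"
  shows "f = g"
  using assms poly_inject_degree_less_card by (auto simp: perm_polys_def)

lemma bij_poly_perm: "f \<in> perm_polys \<Longrightarrow> bij (poly f)"
  by (simp add: perm_polys_def)

lemma poly_perm_comp: "poly (perm_comp f g) = poly f \<circ> poly g"
  by (simp add: fun_eq_iff perm_comp_def poly_pcompose)

lemma perm_comp_in_perm_polys:
  "f \<in> perm_polys \<Longrightarrow> g \<in> perm_polys \<Longrightarrow> perm_comp f g \<in> perm_polys"
  by (simp add: perm_polys_def poly_perm_comp bij_comp)
    (simp add: perm_comp_def degree_mod_vanishing_poly)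

lemma poly_monom_1_1: "poly (monom 1 1 :: 'a::comm_semiring_1 poly) = id"
  by (simp add: fun_eq_iff poly_monom)

lemma monom_1_1_in_perm_polys: "monom 1 1 \<in> (perm_polys :: 'a::{finite,field} poly set)"
  using card_field_gt_1[where 'a = 'a]
  by (simp add: perm_polys_def degree_monom_eq poly_monom_1_1 del: One_nat_def)

text \<open>The inverse function is interpolated by a polynomial of degree below q; uniqueness of
  inverse functions and of the interpolant then resolves the \<open>THE\<close>.\<close>

lemma perm_inv:
  assumes "f \<in> perm_polys"
  shows perm_inv_in_perm_polys: "perm_inv f \<in> perm_polys"
    and poly_perm_inv: "poly (perm_inv f) = inv (poly f)"
proof -
  have bij: "bij (poly f)"
    using assms by (rule bij_poly_perm)
  obtain h where "degree h < CARD('a)" and h: "poly h = inv (poly f)"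
    by (rule exists_poly_eq_fun)
  then have h_perm: "h \<in> perm_polys"
    by (simp add: perm_polys_def bij bij_imp_bij_inv)
  have "perm_inv f = h"
    unfolding perm_inv_def
  proof (rule the_equality)
    have "perm_comp f h = monom 1 1" "perm_comp h f = monom 1 1"
      using bij_is_surj[OF bij] bij_is_inj[OF bij]
      by (auto intro!: perm_polys_eqI perm_comp_in_perm_polys monom_1_1_in_perm_polys h_perm assms
          simp: poly_perm_comp h poly_monom_1_1 surj_iff inj_iff simp del: One_nat_def)
    with h_perm show "h \<in> perm_polys \<and> perm_comp f h = monom 1 1 \<and> perm_comp h f = monom 1 1"
      by blast
  next
    fix g
    assume g: "g \<in> perm_polys \<and> perm_comp f g = monom 1 1 \<and> perm_comp g f = monom 1 1"
    then have "poly g \<circ> poly f = id"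
      \<comment> \<open>A left inverse of a surjection is its inverse, so this one composition
        already determines \<open>poly g\<close>.\<close>
      by (metis poly_monom_1_1 poly_perm_comp)
    then have "poly g = inv (poly f)"
      using bij_is_surj[OF bij] by (metis comp_assoc comp_id id_comp surj_iff)
    with g h h_perm show "g = h"
      by (intro perm_polys_eqI) auto
  qed
  with h h_perm show "perm_inv f \<in> perm_polys" "poly (perm_inv f) = inv (poly f)"
    by simp_all
qed

abbreviation eval_at :: "'a::{finite,field} poly poly \<Rightarrow> 'a \<Rightarrow> 'a \<Rightarrow> 'a" where
  "eval_at \<equiv> eval2 (\<lambda>c. c)"

lemma poly_map_poly_hom:
  fixes \<phi> :: "'b::comm_ring_1 \<Rightarrow> 'c::comm_ring_1" and \<iota> :: "'a::zero \<Rightarrow> 'b"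
  assumes "\<iota> 0 = 0" "\<phi> 0 = 0" "\<And>x y. \<phi> (x + y) = \<phi> x + \<phi> y" "\<And>x y. \<phi> (x * y) = \<phi> x * \<phi> y"
  shows "\<phi> (poly (map_poly \<iota> p) u) = poly (map_poly (\<lambda>c. \<phi> (\<iota> c)) p) (\<phi> u)"
  by (induction p) (simp_all add: assms map_poly_pCons)

text \<open>Ring homomorphisms commute with substitution; \<open>poly_map_poly_hom\<close> is
  applied once per variable. Below, \<phi> is always evaluation at a point, which turns polynomial
  identities into identities of values.\<close>

lemma eval2_hom:
  fixes \<phi> :: "'b::comm_ring_1 \<Rightarrow> 'c::comm_ring_1"
  assumes "\<iota> 0 = 0" "\<phi> 0 = 0" "\<And>x y. \<phi> (x + y) = \<phi> x + \<phi> y" "\<And>x y. \<phi> (x * y) = \<phi> x * \<phi> y"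
  shows "\<phi> (eval2 \<iota> f u v) = eval2 (\<lambda>c. \<phi> (\<iota> c)) f (\<phi> u) (\<phi> v)"
  unfolding eval2_def by (subst poly_map_poly_hom) (simp_all add: assms poly_map_poly_hom)

text \<open>Substituting for y first and then for x exhibits evaluation at a point as a ring
  homomorphism in f, which \<open>eval2\<close> hides.\<close>

lemma eval_at_eq: "eval_at f a b = poly (poly f [:b:]) a"
proof -
  have "eval_at f a b = poly (map_poly (\<lambda>c. poly c a) f) b"
    by (simp add: eval2_def)
  also have "\<dots> = poly (poly f [:b:]) a"
    by (induction f) (simp_all add: map_poly_pCons)
  finally show ?thesis .
qed

lemma poly_odot: "poly (odot f g1 g2) a = eval_at f (poly g1 a) (poly g2 a)"
  unfolding odot_def poly_mod_vanishing_poly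
  by (subst eval2_hom[where \<phi> = "\<lambda>p. poly p a"]) simp_all

lemma eval_at_embed_y: "poly (poly (map_poly (\<lambda>c. [:c:]) p) [:b:]) a = poly p b"
  by (induction p) (simp_all add: map_poly_pCons)

text \<open>Both generators of the ideal vanish at every point (a, b), so congruent polynomials have
  equal values there.\<close>

lemma isotopism_eval:
  assumes "isotopism f1 f2 (h1, h2, h3)"
  shows "eval_at f2 (poly h1 a) (poly h2 b) = poly h3 (eval_at f1 a b)"
proof -
  let ?ev = "\<lambda>f. poly (poly f [:b:]) a"
  let ?l = "eval2 (\<lambda>c. [:[:c:]:]) f2 [:h1:] (map_poly (\<lambda>c. [:c:]) h2)"
  let ?r = "poly (map_poly (\<lambda>c. [:[:c:]:]) h3) f1"
  from assms obtain u v
    where "?l - ?r = u * [:vanishing_poly:] + v * map_poly (\<lambda>c. [:c:]) vanishing_poly"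
    by (auto simp: isotopism_def cong2_def)
  then have "?ev (?l - ?r) = 0"
    by (simp add: eval_at_embed_y)
  then have "?ev ?l = ?ev ?r"
    by simp
  moreover have "?ev ?l = eval_at f2 (poly h1 a) (poly h2 b)"
    by (subst eval2_hom[where \<phi> = ?ev]) (simp_all add: eval_at_embed_y)
  moreover have "?ev ?r = poly h3 (eval_at f1 a b)"
    by (subst poly_map_poly_hom[where \<phi> = ?ev]) (simp_all add: eval_at_eq)
  ultimately show ?thesis
    by simp
qed

text \<open>\<open>odot\<close> is already reduced, so its degree bound is automatic and only
  bijectivity remains.\<close>

lemma complete_mappings_iff:
  "g \<in> complete_mappings f \<longleftrightarrow> g \<in> perm_polys \<and> bij (\<lambda>a. eval_at f a (poly g a))"
proof -
  have "poly (odot f (monom 1 1) g) = (\<lambda>a. eval_at f a (poly g a))"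
    by (simp add: fun_eq_iff poly_odot poly_monom)
  moreover have "degree (odot f (monom 1 1) g) < CARD('a)"
    by (simp add: odot_def degree_mod_vanishing_poly)
  ultimately show ?thesis
    by (simp add: complete_mappings_def perm_polys_def)
qed

text \<open>Two-sided multiplication in a group is undone by multiplying with the inverses; both
  cancellations are checked on values.\<close>

lemma bij_betw_perm_comp:
  assumes "h \<in> perm_polys" "k \<in> perm_polys"
  shows "bij_betw (\<lambda>g. perm_comp (perm_comp h g) k) perm_polys perm_polys"
proof (rule bij_betwI[where g = "\<lambda>g. perm_comp (perm_comp (perm_inv h) g) (perm_inv k)"])
  have inv: "poly f (inv (poly f) x) = x" "inv (poly f) (poly f x) = x"
    if "f \<in> perm_polys" for f :: "'a poly" and x
    using bij_poly_perm[OF that] by (simp_all add: bij_is_surj surj_f_inv_f bij_is_inj inv_f_f)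
  fix g :: "'a poly"
  assume g: "g \<in> perm_polys"
  show "perm_comp (perm_comp (perm_inv h) (perm_comp (perm_comp h g) k)) (perm_inv k) = g"
    "perm_comp (perm_comp h (perm_comp (perm_comp (perm_inv h) g) (perm_inv k))) k = g"
    by (rule perm_polys_eqI; simp add: perm_comp_in_perm_polys perm_inv_in_perm_polys assms g
        poly_perm_comp poly_perm_inv fun_eq_iff inv)+
qed (simp_all add: perm_comp_in_perm_polys perm_inv_in_perm_polys assms)

text \<open>
  With \<open>x = h1 a\<close>, the isotopism turns \<open>f2(x, (h2 g h1\<^sup>-\<^sup>1)(x))\<close> into
  \<open>h3(f1(a, g(a)))\<close>.
\<close>

lemma complete_mappings_isotopism_iff:
  assumes iso: "isotopism f1 f2 (h1, h2, h3)" and g: "g \<in> perm_polys"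
  shows "g \<in> complete_mappings f1 \<longleftrightarrow>
    perm_comp (perm_comp h2 g) (perm_inv h1) \<in> complete_mappings f2"
proof -
  let ?k = "perm_comp (perm_comp h2 g) (perm_inv h1)"
  let ?F1 = "\<lambda>a. eval_at f1 a (poly g a)" and ?F2 = "\<lambda>x. eval_at f2 x (poly ?k x)"
  have h: "h1 \<in> perm_polys" "h2 \<in> perm_polys" "h3 \<in> perm_polys"
    using iso by (auto simp: isotopism_def)
  have "poly ?k (poly h1 a) = poly h2 (poly g a)" for a
    using h bij_poly_perm[of h1]
    by (simp add: poly_perm_comp poly_perm_inv bij_is_inj inv_f_f)
  then have eq: "?F2 \<circ> poly h1 = poly h3 \<circ> ?F1"
    by (simp add: fun_eq_iff isotopism_eval[OF iso])
  \<comment> \<open>Composing with a bijection, here h3 on the left and then h1 on the right,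
    neither creates nor destroys bijectivity.\<close>
  have "bij ?F1 \<longleftrightarrow> bij (poly h3 \<circ> ?F1)"
    by (rule bij_betw_comp_iff2[OF bij_poly_perm[OF h(3)]]) simp
  also have "\<dots> \<longleftrightarrow> bij ?F2"
    unfolding eq[symmetric] by (rule bij_betw_comp_iff[OF bij_poly_perm[OF h(1)], symmetric])
  finally show ?thesis
    by (simp add: complete_mappings_iff perm_comp_in_perm_polys perm_inv_in_perm_polys g h)
qed

lemma bij_betw_complete_mappings:
  assumes iso: "isotopism f1 f2 (h1, h2, h3)"
  shows "bij_betw (\<lambda>g. perm_comp (perm_comp h2 g) (perm_inv h1))
    (complete_mappings f1) (complete_mappings f2)"
proof -
  let ?\<Phi> = "\<lambda>g. perm_comp (perm_comp h2 g) (perm_inv h1)"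
  have bij: "bij_betw ?\<Phi> perm_polys perm_polys"
    using iso by (intro bij_betw_perm_comp) (auto simp: isotopism_def perm_inv_in_perm_polys)
  have sub: "complete_mappings f \<subseteq> perm_polys" for f :: "'a poly poly"
    by (auto simp: complete_mappings_def)
  have "?\<Phi> ` complete_mappings f1 = complete_mappings f2"
  proof (intro equalityI subsetI)
    \<comment> \<open>The preimage of k is first found among all of \<open>perm_polys\<close>; the
      equivalence then places it in \<open>complete_mappings f1\<close>.\<close>
    fix k assume k: "k \<in> complete_mappings f2"
    with sub bij obtain g where "g \<in> perm_polys" "k = ?\<Phi> g"
      unfolding bij_betw_def by blast
    with k show "k \<in> ?\<Phi> ` complete_mappings f1"
      using complete_mappings_isotopism_iff[OF iso] by blast
  next
    fix k assume "k \<in> ?\<Phi> ` complete_mappings f1"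
    then show "k \<in> complete_mappings f2"
      using complete_mappings_isotopism_iff[OF iso] sub by blast
  qed
  with bij show ?thesis
    by (rule bij_betw_subset[OF _ sub])
qed

theorem proposition5p1:
  fixes f1 f2 :: "'a::{finite,field} poly poly"
  assumes "f1 \<in> local_perm_polys" and "f2 \<in> local_perm_polys"
  shows "(isotopic f1 f2 \<longrightarrow>
            (\<exists>\<Phi>. bij_betw \<Phi> (complete_mappings f1) (complete_mappings f2))) \<and>
         (\<forall>h1 h2 h3. isotopism f1 f2 (h1, h2, h3) \<longrightarrow>
            bij_betw (\<lambda>g. perm_comp (perm_comp h2 g) (perm_inv h1))
              (complete_mappings f1) (complete_mappings f2) \<and>
            (\<forall>g \<in> perm_polys.
               perm_comp (perm_comp h2 g) (perm_inv h1) \<in> perm_polys \<and>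
               (g \<in> complete_mappings f1 \<longleftrightarrow>
                perm_comp (perm_comp h2 g) (perm_inv h1) \<in> complete_mappings f2)))"
proof (intro conjI impI allI ballI)
  assume "isotopic f1 f2"
  then obtain h1 h2 h3 where "isotopism f1 f2 (h1, h2, h3)"
    unfolding isotopic_def by (metis prod_cases3)
  then show "\<exists>\<Phi>. bij_betw \<Phi> (complete_mappings f1) (complete_mappings f2)"
    using bij_betw_complete_mappings by blast
next
  fix h1 h2 h3 g :: "'a poly"
  assume "isotopism f1 f2 (h1, h2, h3)" "g \<in> perm_polys"
  then show "perm_comp (perm_comp h2 g) (perm_inv h1) \<in> perm_polys"
    by (auto simp: isotopism_def perm_comp_in_perm_polys perm_inv_in_perm_polys)
qed (simp_all add: bij_betw_complete_mappings complete_mappings_isotopism_iff)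

end
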